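(* Let $m>0$, $\mu>0$, $v>0$, $n\in\mathbb{R}$, $\varepsilon\in\{-1,1\}$, and consider the $n$th power central force $\mathbf{F}(\mathbf{r})=\varepsilon m r^n\,\mathbf{r}/r$. A circle of radius $R$ centered at the origin is a constant-speed ramp with velocity $v$ exactly when $\varepsilon=-1$ and $v=R^{(n+1)/2}$ (and no other circles are constant-speed ramps). Consequently, for $\varepsilon=-1$: 1. If $n\neq -1$, then for each value of $v>0$ there is exactly one circle that is a constant-speed ramp with velocity $v$. 2. If $n=-1$ (inverse central harmonic oscillator), circular constant-speed ramps exist only if $v=1$, and in that case every circle centered at the origin is a constant-speed ramp.
   Context: Let $J(x,y)=(-y,x)$. For a smooth curve $\alpha:I\to\mathbb{R}^2\setminus\{0\}$ parametrized by arc-length, $\mathbf{n}(s)=J\alpha'(s)$ and $\kappa(s)=\langle\alpha''(s),\mathbf{n}(s)\rangle$. An arc-length parametrized curve $\alpha$ is a constant-speed ramp with velocity $v$ for the central force $\mathbf{F}(\mathbf{r})=\varepsilon m r^n\,\mathbf{r}/r$ and kinetic friction coefficient $\mu>0$ if, with $r=|\alpha(s)|$, for all $s\in I$: $\varepsilon\langle\alpha(s),\alpha'(s)\rangle\ge 0$ and $$\kappa(s)=\frac{\varepsilon}{v^2}\,r^{n-1}\left(\frac{\langle\alpha(s),\alpha'(s)\rangle}{\mu}+\langle\alpha(s),\mathbf{n}(s)\rangle\right).$$ A circle (not passing through the origin) is a constant-speed ramp if the arc-length parametrization $\alpha(s)=(a,b)+R(\cos(s/R),\sin(s/R))$, $s\in\mathbb{R}$,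 of the whole circle is one. *)

theory Defs
  imports "HOL-Analysis.Analysis"
begin

type_synonym plane = "real \<times> real"

fun J :: "plane \<Rightarrow> plane" where
  "J (x, y) = (- y, x)"

text \<open>Derivatives are taken within the parameter interval \<open>I\<close>, hence are one-sided at any
  end points belonging to \<open>I\<close>.\<close>

definition tangent :: "real set \<Rightarrow> (real \<Rightarrow> plane) \<Rightarrow> real \<Rightarrow> plane" where
  "tangent I \<alpha> s = vector_derivative \<alpha> (at s within I)"

definition normal :: "real set \<Rightarrow> (real \<Rightarrow> plane) \<Rightarrow> real \<Rightarrow> plane" where
  "normal I \<alpha> s = J (tangent I \<alpha> s)"

definition curvature :: "real set \<Rightarrow> (real \<Rightarrow> plane) \<Rightarrow> real \<Rightarrow> real" where
  "curvature I \<alpha> s = vector_derivative (tangent I \<alpha>) (at s within I) \<bullet> normal I \<alpha> s"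

text \<open>Infinite differentiability; \<open>D k\<close> is the \<open>k\<close>-th derivative.\<close>

definition smooth_curve_on :: "real set \<Rightarrow> (real \<Rightarrow> plane) \<Rightarrow> bool" where
  "smooth_curve_on I \<alpha> \<longleftrightarrow>
     (\<exists>D :: nat \<Rightarrow> real \<Rightarrow> plane. D 0 = \<alpha> \<and>
        (\<forall>k. \<forall>s\<in>I. (D k has_vector_derivative D (Suc k) s) (at s within I)))"

definition arc_length_curve :: "real set \<Rightarrow> (real \<Rightarrow> plane) \<Rightarrow> bool" where
  "arc_length_curve I \<alpha> \<longleftrightarrow>
     is_interval I \<and> (\<exists>a\<in>I. \<exists>b\<in>I. a < b) \<and> smooth_curve_on I \<alpha> \<and>
     (\<forall>s\<in>I. \<alpha> s \<noteq> 0 \<and> norm (tangent I \<alpha> s) = 1)"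

definition power_central_force :: "real \<Rightarrow> real \<Rightarrow> real \<Rightarrow> plane \<Rightarrow> plane" where
  "power_central_force \<epsilon> m n p = (\<epsilon> * m * norm p powr n) *\<^sub>R (p /\<^sub>R norm p)"

text \<open>The arguments \<open>\<epsilon>\<close>, \<open>m\<close>, \<open>n\<close> specify the force \<open>power_central_force \<epsilon> m n\<close>, \<open>\<mu>\<close> is the
  kinetic friction coefficient and \<open>v\<close> the velocity. The mass \<open>m\<close> cancels from the defining
  conditions; see \<open>constant_speed_ramp_force_iff\<close> below.\<close>

definition constant_speed_ramp ::
    "real \<Rightarrow> real \<Rightarrow> real \<Rightarrow> real \<Rightarrow> real \<Rightarrow> real set \<Rightarrow> (real \<Rightarrow> plane) \<Rightarrow> bool" where
  "constant_speed_ramp \<epsilon> m n \<mu> v I \<alpha> \<longleftrightarrow>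
     arc_length_curve I \<alpha> \<and>
     (\<forall>s\<in>I. \<epsilon> * (\<alpha> s \<bullet> tangent I \<alpha> s) \<ge> 0 \<and>
        curvature I \<alpha> s =
          \<epsilon> / v\<^sup>2 * norm (\<alpha> s) powr (n - 1) *
            ((\<alpha> s \<bullet> tangent I \<alpha> s) / \<mu> + \<alpha> s \<bullet> normal I \<alpha> s))"

lemma constant_speed_ramp_force_iff:
  assumes "m > 0"
  shows "constant_speed_ramp \<epsilon> m n \<mu> v I \<alpha> \<longleftrightarrow>
     arc_length_curve I \<alpha> \<and>
     (\<forall>s\<in>I. power_central_force \<epsilon> m n (\<alpha> s) \<bullet> tangent I \<alpha> s \<ge> 0 \<and>
        curvature I \<alpha> s = 1 / (m * v\<^sup>2) *
          ((power_central_force \<epsilon> m n (\<alpha> s) \<bullet> tangent I \<alpha> s) / \<mu> +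
            power_central_force \<epsilon> m n (\<alpha> s) \<bullet> normal I \<alpha> s))"
proof (cases "arc_length_curve I \<alpha>")
  case True
  have inner_force: "power_central_force \<epsilon> m n p \<bullet> w
      = m * norm p powr (n - 1) * (\<epsilon> * (p \<bullet> w))" if "p \<noteq> 0" for p w
    using that by (simp add: power_central_force_def powr_diff field_simps)
  have "(power_central_force \<epsilon> m n (\<alpha> s) \<bullet> tangent I \<alpha> s \<ge> 0 \<longleftrightarrow>
          \<epsilon> * (\<alpha> s \<bullet> tangent I \<alpha> s) \<ge> 0) \<and>
        1 / (m * v\<^sup>2) *
          ((power_central_force \<epsilon> m n (\<alpha> s) \<bullet> tangent I \<alpha> s) / \<mu> +
            power_central_force \<epsilon> m n (\<alpha> s) \<bullet> normal I \<alpha> s) =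
        \<epsilon> / v\<^sup>2 * norm (\<alpha> s) powr (n - 1) *
            ((\<alpha> s \<bullet> tangent I \<alpha> s) / \<mu> + \<alpha> s \<bullet> normal I \<alpha> s)"
    if "s \<in> I" for s
  proof -
    have nz: "\<alpha> s \<noteq> 0"
      using True that by (simp add: arc_length_curve_def)
    define q where "q = norm (\<alpha> s) powr (n - 1)"
    have "q > 0"
      using nz by (simp add: q_def)
    with assms have pos: "m * q > 0"
      by simp
    have "0 \<le> m * q * x \<longleftrightarrow> 0 \<le> x" for x :: real
      by (rule zero_le_mult_iff[of "m * q", THEN trans]) (use pos in auto)
    moreover have "1 / (m * v\<^sup>2) * (m * q * (\<epsilon> * x) / \<mu> + m * q * (\<epsilon> * y)) =
        \<epsilon> / v\<^sup>2 * q * (x / \<mu> + y)" for x y :: real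
    proof -
      have "m * q * (\<epsilon> * x) / \<mu> + m * q * (\<epsilon> * y) = m * (q * \<epsilon> * (x / \<mu> + y))"
        by (simp add: algebra_simps)
      then show ?thesis
        using assms by simp
    qed
    ultimately show ?thesis
      by (simp only: inner_force[OF nz] q_def[symmetric] simp_thms)
  qed
  then show ?thesis
    by (simp add: constant_speed_ramp_def)
qed (simp add: constant_speed_ramp_def)

definition circle_param :: "plane \<Rightarrow> real \<Rightarrow> real \<Rightarrow> plane" where
  "circle_param c R s = c + R *\<^sub>R (cos (s / R), sin (s / R))"

definition ramp_circle :: "real \<Rightarrow> real \<Rightarrow> real \<Rightarrow> real \<Rightarrow> real \<Rightarrow> plane set \<Rightarrow> bool" where
  "ramp_circle \<epsilon> m n \<mu> v C \<longleftrightarrow>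
     (\<exists>c R. R > 0 \<and> C = sphere c R \<and> 0 \<notin> C \<and>
        constant_speed_ramp \<epsilon> m n \<mu> v UNIV (circle_param c R))"

end

theory Submission
  imports Defs
begin

text \<open>On a whole circle with centre \<open>c\<close> the tangential component \<open>\<langle>\<alpha>, \<alpha>'\<rangle> = \<langle>c, \<alpha>'\<rangle>\<close> changes sign
  under the antipodal map, so the sign condition forces it to vanish identically, which means
  \<open>c = 0\<close>. On a centred circle the curvature equation reads \<open>1 / R = - \<epsilon> R\<^sup>n / v\<^sup>2\<close>, that is,
  \<open>\<epsilon> = -1\<close> and \<open>v\<^sup>2 = R\<^bsup>n+1\<^esup>\<close>; for \<open>n \<noteq> -1\<close> this has exactly one positive solution \<open>R\<close>.\<close>

text \<open>The phase \<open>d\<close> lets one formula serve every derivative of the circle, since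
  each differentiation advances the phase by a quarter turn.\<close>

lemma has_vector_derivative_unit_circle:
  fixes R d :: real
  assumes "R \<noteq> 0"
  shows "((\<lambda>s. (cos (s / R + d), sin (s / R + d))) has_vector_derivative
     (1 / R) *\<^sub>R (- sin (s / R + d), cos (s / R + d))) (at s)"
proof -
  have "((\<lambda>s. cos (s / R + d)) has_vector_derivative - sin (s / R + d) * (1 / R)) (at s)"
    "((\<lambda>s. sin (s / R + d)) has_vector_derivative cos (s / R + d) * (1 / R)) (at s)"
    unfolding has_real_derivative_iff_has_vector_derivative [symmetric]
    using assms by (auto intro!: derivative_eq_intros)
  from has_vector_derivative_Pair [OF this] show ?thesis
    by simp
qed

lemma smooth_curve_on_circle_param:
  fixes c :: plane
  assumes "R > 0"
  shows "smooth_curve_on UNIV (circle_param c R)"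
proof -
  \<comment> \<open>Closed form of the \<open>k\<close>-th derivative: each step rotates by
    \<open>pi / 2\<close> and scales by \<open>1 / R\<close>; the centre survives only in order
    0.\<close>
  define D :: "nat \<Rightarrow> real \<Rightarrow> plane" where
    "D k s = (if k = 0 then c else 0) +
       (R * (1 / R) ^ k) *\<^sub>R (cos (s / R + k * (pi / 2)), sin (s / R + k * (pi / 2)))" for k s
  have "D 0 = circle_param c R"
    by (simp add: D_def circle_param_def fun_eq_iff)
  moreover have "(D k has_vector_derivative D (Suc k) s) (at s)" for k s
  proof -
    have shift: "s / R + Suc k * (pi / 2) = s / R + k * (pi / 2) + pi / 2"
      by (simp add: algebra_simps)
    \<comment> \<open>The summand \<open>0\<close> is the derivative of the constant term, kept so
      that the sum rule matches syntactically.\<close>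
    have eq: "D (Suc k) s = 0 + (R * (1 / R) ^ k) *\<^sub>R
        ((1 / R) *\<^sub>R (- sin (s / R + k * (pi / 2)), cos (s / R + k * (pi / 2))))"
      unfolding D_def shift cos_add [of _ "pi / 2"] sin_add [of _ "pi / 2"]
      by (simp add: field_simps)
    show ?thesis
      unfolding eq unfolding D_def [abs_def]
      by (intro has_vector_derivative_add has_vector_derivative_const
          has_vector_derivative_unit_circle
          bounded_linear.has_vector_derivative [OF bounded_linear_scaleR_right])
        (use assms in simp)
  qed
  ultimately show ?thesis
    unfolding smooth_curve_on_def by auto
qed

lemma tangent_circle_param:
  assumes "R > 0"
  shows "tangent UNIV (circle_param c R) s = (- sin (s / R), cos (s / R))"
proof -
  have "((\<lambda>s. c + R *\<^sub>R (cos (s / R + 0), sin (s / R + 0))) has_vector_derivative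
      0 + R *\<^sub>R ((1 / R) *\<^sub>R (- sin (s / R + 0), cos (s / R + 0)))) (at s)"
    by (intro has_vector_derivative_add has_vector_derivative_const
        has_vector_derivative_unit_circle
        bounded_linear.has_vector_derivative [OF bounded_linear_scaleR_right])
      (use assms in simp)
  from vector_derivative_at [OF this] show ?thesis
    using assms by (simp add: tangent_def circle_param_def [abs_def])
qed

lemma normal_circle_param:
  assumes "R > 0"
  shows "normal UNIV (circle_param c R) s = - (cos (s / R), sin (s / R))"
  using assms by (simp add: normal_def tangent_circle_param)

lemma inner_unit_circle:
  fixes t :: real
  shows "(cos t, sin t) \<bullet> (cos t, sin t) = 1"
  using sin_cos_squared_add2 [of t] by (simp add: power2_eq_square)

lemma curvature_circle_param:
  assumes "R > 0"
  shows "curvature UNIV (circle_param c R) s = 1 / R"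
proof -
  \<comment> \<open>The tangent is itself a unit circle with phase \<open>pi / 2\<close>, so the
    same derivative formula applies a second time.\<close>
  have "tangent UNIV (circle_param c R) =
      (\<lambda>s. (cos (s / R + pi / 2), sin (s / R + pi / 2)))"
    using assms by (simp add: tangent_circle_param fun_eq_iff cos_add sin_add)
  then have "vector_derivative (tangent UNIV (circle_param c R)) (at s) =
      (1 / R) *\<^sub>R (- sin (s / R + pi / 2), cos (s / R + pi / 2))"
    using assms by (simp add: vector_derivative_at [OF has_vector_derivative_unit_circle])
  also have "\<dots> = (1 / R) *\<^sub>R (- (cos (s / R), sin (s / R)))"
    by (simp add: cos_add sin_add)
  finally show ?thesis
    using assms
    by (simp add: curvature_def normal_circle_param inner_unit_circle
        del: inner_Pair uminus_Pair scaleR_Pair)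
qed

lemma norm_circle_param_0:
  assumes "R > 0"
  shows "norm (circle_param 0 R s) = R"
  using assms by (simp add: circle_param_def norm_eq_sqrt_inner inner_unit_circle
      del: inner_Pair scaleR_Pair)

lemma arc_length_curve_circle_param_0:
  assumes "R > 0"
  shows "arc_length_curve UNIV (circle_param 0 R)"
proof -
  have "circle_param 0 R s \<noteq> 0" for s
    using norm_circle_param_0 [OF assms, of s] assms by auto
  moreover have "norm (tangent UNIV (circle_param 0 R) s) = 1" for s
    using assms by (simp add: tangent_circle_param norm_Pair)
  moreover have "\<exists>a b :: real. a < b"
    using zero_less_one by blast
  ultimately show ?thesis
    using assms by (simp add: arc_length_curve_def smooth_curve_on_circle_param)
qed

text \<open>The radial part of the position is orthogonal to the tangent, so only the centre
  contributes.\<close>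

lemma inner_circle_param_tangent:
  assumes "R > 0"
  shows "circle_param c R s \<bullet> tangent UNIV (circle_param c R) s =
    c \<bullet> (- sin (s / R), cos (s / R))"
  using assms by (simp add: circle_param_def tangent_circle_param inner_add_left)

lemma centre_eq_0_of_inner_tangent_sign:
  assumes "R > 0" "\<epsilon> \<noteq> 0"
    and sign: "\<And>s. \<epsilon> * (circle_param c R s \<bullet> tangent UNIV (circle_param c R) s) \<ge> 0"
  shows "c = 0"
proof -
  obtain a b where c: "c = (a, b)"
    by (cases c)
  have "\<epsilon> * (b * cos t - a * sin t) \<ge> 0" for t
    using sign [of "R * t"] assms(1) by (simp add: inner_circle_param_tangent c)
  \<comment> \<open>Two antipodal pairs suffice: 0 and \<open>pi\<close> bound
    \<open>\<epsilon> * b\<close> from both sides, and the angles \<open>pi / 2\<close> and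
    \<open>- (pi / 2)\<close> do the same for \<open>\<epsilon> * a\<close>.\<close>
  from this [of 0] this [of pi] this [of "pi / 2"] this [of "- (pi / 2)"]
  have "\<epsilon> * a = 0" "\<epsilon> * b = 0"
    by simp_all
  with assms(2) show ?thesis
    by (simp add: c zero_prod_def)
qed

lemma powr_half_eq_iff:
  fixes v R p :: real
  assumes "v > 0" "R > 0"
  shows "v = R powr (p / 2) \<longleftrightarrow> v\<^sup>2 = R powr p"
proof -
  have "v = R powr (p / 2) \<longleftrightarrow> v\<^sup>2 = (R powr (p / 2))\<^sup>2"
    using assms by simp
  also have "(R powr (p / 2))\<^sup>2 = R powr p"
    by (simp add: power2_eq_square flip: powr_add)
  finally show ?thesis .
qed

text \<open>Position and tangent are orthogonal here, so the sign condition is trivial and the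
  friction term vanishes. The remaining quantities are constant along the circle, which leaves a
  single scalar equation.\<close>

lemma constant_speed_ramp_circle_param_0_iff:
  assumes "v > 0" "R > 0" "\<epsilon> \<in> {-1, 1}"
  shows "constant_speed_ramp \<epsilon> m n \<mu> v UNIV (circle_param 0 R) \<longleftrightarrow>
    \<epsilon> = -1 \<and> v = R powr ((n + 1) / 2)"
proof -
  have normal_part:
    "circle_param 0 R s \<bullet> normal UNIV (circle_param 0 R) s = - R" for s
    using assms(2)
    by (simp add: circle_param_def normal_circle_param inner_unit_circle
        del: inner_Pair uminus_Pair scaleR_Pair)
  have "constant_speed_ramp \<epsilon> m n \<mu> v UNIV (circle_param 0 R) \<longleftrightarrow>
      1 / R = \<epsilon> / v\<^sup>2 * R powr (n - 1) * (- R)"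
    using assms(2)
    by (simp add: constant_speed_ramp_def arc_length_curve_circle_param_0
        inner_circle_param_tangent curvature_circle_param norm_circle_param_0 normal_part)
  also have "\<dots> \<longleftrightarrow> v\<^sup>2 = - \<epsilon> * R powr (n + 1)"
  proof -
    \<comment> \<open>Here \<open>q\<close> stands for \<open>R powr (n - 1)\<close>, so that
      clearing denominators leaves the power untouched.\<close>
    have "1 / R = \<epsilon> / v\<^sup>2 * q * (- R) \<longleftrightarrow> v\<^sup>2 = - \<epsilon> * (q * R\<^sup>2)" for q
      using assms(1,2) by (simp add: field_simps power2_eq_square)
    moreover have "R powr (n - 1) * R\<^sup>2 = R powr (n + 1)"
      using powr_add [of R "n - 1" 2] assms(2) by (simp add: add.commute)
    ultimately show ?thesis
      by simp
  qed
  also have "\<dots> \<longleftrightarrow> \<epsilon> = -1 \<and> v\<^sup>2 = R powr (n + 1)"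
  proof -
    \<comment> \<open>Positivity excludes \<open>\<epsilon> = 1\<close>, which would make
      \<open>v\<^sup>2\<close> negative.\<close>
    have "v\<^sup>2 > 0" "R powr (n + 1) > 0"
      using assms by simp_all
    then have "v\<^sup>2 \<noteq> - (R powr (n + 1))"
      by linarith
    then show ?thesis
      using assms(3) by auto
  qed
  finally show ?thesis
    using powr_half_eq_iff [OF assms(1,2), of "n + 1"] by simp
qed

lemma ramp_circle_iff:
  assumes "v > 0" "\<epsilon> \<in> {-1, 1}"
  shows "ramp_circle \<epsilon> m n \<mu> v C \<longleftrightarrow>
    \<epsilon> = -1 \<and> (\<exists>R>0. C = sphere 0 R \<and> v = R powr ((n + 1) / 2))"
proof
  assume "ramp_circle \<epsilon> m n \<mu> v C"
  then obtain c R where R: "R > 0" and C: "C = sphere c R"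
    and ramp: "constant_speed_ramp \<epsilon> m n \<mu> v UNIV (circle_param c R)"
    unfolding ramp_circle_def by blast
  have "c = 0"
    using ramp assms(2)
    by (intro centre_eq_0_of_inner_tangent_sign [OF R, of \<epsilon>]) (auto simp: constant_speed_ramp_def)
  with ramp C R show "\<epsilon> = -1 \<and> (\<exists>R>0. C = sphere 0 R \<and> v = R powr ((n + 1) / 2))"
    using constant_speed_ramp_circle_param_0_iff [OF assms(1) R assms(2)] by auto
next
  assume "\<epsilon> = -1 \<and> (\<exists>R>0. C = sphere 0 R \<and> v = R powr ((n + 1) / 2))"
  then show "ramp_circle \<epsilon> m n \<mu> v C"
    using constant_speed_ramp_circle_param_0_iff [OF assms(1) _ assms(2)]
    \<comment> \<open>The origin lies off the circle because its distance to the centre is 0, not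
      \<open>R\<close>.\<close>
    unfolding ramp_circle_def by (metis dist_self less_irrefl mem_sphere)
qed

text \<open>Ramp circles are point sets, so the radius has to be recovered from the set; the point
  \<open>(R, 0)\<close> reveals it.\<close>

lemma sphere_0_eq_iff:
  fixes R R' :: real
  assumes "R > 0"
  shows "sphere (0 :: plane) R = sphere 0 R' \<longleftrightarrow> R = R'"
proof
  assume eq: "sphere (0 :: plane) R = sphere 0 R'"
  have "(R, 0) \<in> sphere (0 :: plane) R"
    using assms by (simp add: norm_Pair)
  then show "R = R'"
    using assms unfolding eq by (simp add: norm_Pair)
qed simp

text \<open>A nonzero power is a bijection of the positive reals; solving for \<open>R\<close>
  yields existence and uniqueness of the radius together.\<close>

lemma eq_powr_iff_powr_inverse_eq:
  fixes v R p :: real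
  assumes "v > 0" "R > 0" "p \<noteq> 0"
  shows "v = R powr p \<longleftrightarrow> R = v powr (1 / p)"
  using assms by (auto simp: powr_powr)

theorem corollary2p6:
  fixes m \<mu> v n \<epsilon> :: real
  assumes "m > 0" and "\<mu> > 0" and "v > 0" and "\<epsilon> \<in> {-1, 1}"
  shows
    "(\<forall>R>0. ramp_circle \<epsilon> m n \<mu> v (sphere 0 R) \<longleftrightarrow>
        \<epsilon> = -1 \<and> v = R powr ((n + 1) / 2)) \<and>
     (\<forall>C. ramp_circle \<epsilon> m n \<mu> v C \<longrightarrow> (\<exists>R>0. C = sphere 0 R)) \<and>
     (\<epsilon> = -1 \<longrightarrow>
        (n \<noteq> -1 \<longrightarrow> (\<exists>!C. ramp_circle \<epsilon> m n \<mu> v C)) \<and>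
        (n = -1 \<longrightarrow>
           ((\<exists>C. ramp_circle \<epsilon> m n \<mu> v C) \<longrightarrow> v = 1) \<and>
           (v = 1 \<longrightarrow> (\<forall>R>0. ramp_circle \<epsilon> m n \<mu> v (sphere 0 R)))))"
proof -
  note iff = ramp_circle_iff [OF assms(3,4), of m n \<mu>]
  have "ramp_circle \<epsilon> m n \<mu> v (sphere 0 R) \<longleftrightarrow> \<epsilon> = -1 \<and> v = R powr ((n + 1) / 2)"
    if "R > 0" for R
    using that by (auto simp: iff sphere_0_eq_iff)
  moreover have "\<exists>R>0. C = sphere 0 R" if "ramp_circle \<epsilon> m n \<mu> v C" for C
    using that by (auto simp: iff)
  moreover have "\<exists>!C. ramp_circle \<epsilon> m n \<mu> v C" if "\<epsilon> = -1" "n \<noteq> -1"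
  proof -
    have "v = R powr ((n + 1) / 2) \<longleftrightarrow> R = v powr (1 / ((n + 1) / 2))" if "R > 0" for R
      using that assms(3) \<open>n \<noteq> -1\<close> by (intro eq_powr_iff_powr_inverse_eq) auto
    then have "ramp_circle \<epsilon> m n \<mu> v C \<longleftrightarrow> C = sphere 0 (v powr (1 / ((n + 1) / 2)))" for C
      using that assms(3) unfolding iff by (metis powr_gt_zero less_irrefl)
    then show ?thesis
      by simp
  qed
  \<comment> \<open>For \<open>n = -1\<close> the exponent is 0, and \<open>R powr 0 = 1\<close> for
    every \<open>R > 0\<close>, so the condition on \<open>v\<close> no longer depends on the
    radius.\<close>
  moreover have "v = 1" if "n = -1" "ramp_circle \<epsilon> m n \<mu> v C" for C
    using that(2) unfolding iff by (auto simp: that(1))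
  moreover have "ramp_circle \<epsilon> m n \<mu> v (sphere 0 R)" if "\<epsilon> = -1" "n = -1" "v = 1" "R > 0" for R
    unfolding iff using that by (intro conjI exI [of _ R]) simp_all
  ultimately show ?thesis
    by blast
qed

end
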